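(* Let $R$ be a ring and $M$ a finitely generated left $R$-module. The following statements are equivalent: (a) $M$ is Rad-supplemented; (b) every maximal submodule of $M$ has a Rad-supplement in $M$; (c) $M$ is the sum of finitely many w-local submodules.
   Context: All rings are associative with identity and all modules are unital left modules. $\mathrm{Rad}(L)$ denotes the radical of a module $L$: the intersection of all maximal submodules of $L$, or $L$ itself if $L$ has no maximal submodules. For submodules $N, L$ of a module $M$, $L$ is called a Rad-supplement of $N$ in $M$ if $N+L=M$ and $N\cap L\subseteq \mathrm{Rad}(L)$. A module $M$ is Rad-supplemented if every submodule of $M$ has a Rad-supplement in $M$. A module is w-local if it has a unique maximal submodule. The empty sum of submodules (equal to the zero submodule) counts as a finite sum. *)

theory Defs
  imports "HOL-Algebra.Module" "HOL-Algebra.AbelCoset"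
begin

text \<open>
  The locale \<^locale>\<open>module\<close> assumes a commutative ring of scalars. The following
  locale has the same axioms over an arbitrary ring with identity (the zero ring is allowed).
  The locale \<^locale>\<open>submodule\<close> does not refer to commutativity and is used as it is.
\<close>

locale left_module = R?: ring R + M?: abelian_group M for R (structure) and M (structure) +
  assumes smult_closed [simp, intro]:
      "\<lbrakk>a \<in> carrier R; x \<in> carrier M\<rbrakk> \<Longrightarrow> a \<odot>\<^bsub>M\<^esub> x \<in> carrier M"
    and smult_l_distr:
      "\<lbrakk>a \<in> carrier R; b \<in> carrier R; x \<in> carrier M\<rbrakk> \<Longrightarrow>
      (a \<oplus> b) \<odot>\<^bsub>M\<^esub> x = a \<odot>\<^bsub>M\<^esub> x \<oplus>\<^bsub>M\<^esub> b \<odot>\<^bsub>M\<^esub> x"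
    and smult_r_distr:
      "\<lbrakk>a \<in> carrier R; x \<in> carrier M; y \<in> carrier M\<rbrakk> \<Longrightarrow>
      a \<odot>\<^bsub>M\<^esub> (x \<oplus>\<^bsub>M\<^esub> y) = a \<odot>\<^bsub>M\<^esub> x \<oplus>\<^bsub>M\<^esub> a \<odot>\<^bsub>M\<^esub> y"
    and smult_assoc1:
      "\<lbrakk>a \<in> carrier R; b \<in> carrier R; x \<in> carrier M\<rbrakk> \<Longrightarrow>
      (a \<otimes> b) \<odot>\<^bsub>M\<^esub> x = a \<odot>\<^bsub>M\<^esub> (b \<odot>\<^bsub>M\<^esub> x)"
    and smult_one [simp]:
      "x \<in> carrier M \<Longrightarrow> \<one> \<odot>\<^bsub>M\<^esub> x = x"

lemma module_iff_left_module: "module R M \<longleftrightarrow> cring R \<and> left_module R M"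
  unfolding module_def left_module_def module_axioms_def left_module_axioms_def
  by (auto simp: cring_def)

definition generated_submodule ::
  "('a, 'r) ring_scheme \<Rightarrow> ('a, 'b, 'm) module_scheme \<Rightarrow> 'b set \<Rightarrow> 'b set"
  where "generated_submodule R M S = \<Inter>{N. submodule N R M \<and> S \<subseteq> N}"

definition finitely_generated_module ::
  "('a, 'r) ring_scheme \<Rightarrow> ('a, 'b, 'm) module_scheme \<Rightarrow> bool"
  where "finitely_generated_module R M \<longleftrightarrow>
    (\<exists>S. finite S \<and> S \<subseteq> carrier M \<and> generated_submodule R M S = carrier M)"

definition maximal_submodule ::
  "('a, 'r) ring_scheme \<Rightarrow> ('a, 'b, 'm) module_scheme \<Rightarrow> 'b set \<Rightarrow> bool"
  where "maximal_submodule R L N \<longleftrightarrow> submodule N R L \<and> N \<noteq> carrier L \<and>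
    (\<forall>K. submodule K R L \<and> N \<subseteq> K \<longrightarrow> K = N \<or> K = carrier L)"

definition Rad ::
  "('a, 'r) ring_scheme \<Rightarrow> ('a, 'b, 'm) module_scheme \<Rightarrow> 'b set"
  where "Rad R L =
    (if \<exists>N. maximal_submodule R L N then \<Inter>{N. maximal_submodule R L N} else carrier L)"

text \<open>
  A submodule \<open>L\<close> of \<open>M\<close>, viewed as a module in its own right, is \<open>M\<lparr>carrier := L\<rparr>\<close>.
\<close>

definition Rad_supplement ::
  "('a, 'r) ring_scheme \<Rightarrow> ('a, 'b, 'm) module_scheme \<Rightarrow> 'b set \<Rightarrow> 'b set \<Rightarrow> bool"
  where "Rad_supplement R M N L \<longleftrightarrow> submodule N R M \<and> submodule L R M \<and>
    N <+>\<^bsub>M\<^esub> L = carrier M \<and> N \<inter> L \<subseteq> Rad R (M\<lparr>carrier := L\<rparr>)"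

definition Rad_supplemented ::
  "('a, 'r) ring_scheme \<Rightarrow> ('a, 'b, 'm) module_scheme \<Rightarrow> bool"
  where "Rad_supplemented R M \<longleftrightarrow>
    (\<forall>N. submodule N R M \<longrightarrow> (\<exists>L. Rad_supplement R M N L))"

definition w_local ::
  "('a, 'r) ring_scheme \<Rightarrow> ('a, 'b, 'm) module_scheme \<Rightarrow> bool"
  where "w_local R L \<longleftrightarrow> (\<exists>!N. maximal_submodule R L N)"

text \<open>Used for finite \<open>I\<close> only; for \<open>I = {}\<close> the sum is \<open>{\<zero>\<^bsub>M\<^esub>}\<close>.\<close>

definition submodule_family_sum ::
  "('a, 'b, 'm) module_scheme \<Rightarrow> ('i \<Rightarrow> 'b set) \<Rightarrow> 'i set \<Rightarrow> 'b set"
  where "submodule_family_sum M W I = {finsum M x I | x. x \<in> Pi I W}"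

end

theory Submission
  imports Defs
begin

text \<open>
  Write (a), (b), (c) for: every submodule has a Rad-supplement; every maximal submodule has one;
  \<open>M\<close> is a finite sum of w-local submodules. Since a maximal submodule is a submodule, (a) implies
  (b). Finite generation of \<open>M\<close> enters the other two implications mainly through Zorn's lemma: every
  proper submodule lies in a maximal one (\<open>proper_submodule_in_maximal\<close>). The second tool is
  that intersecting a maximal submodule with a submodule \<open>L\<close> not inside it gives a maximal
  submodule of \<open>L\<close> (\<open>maximal_Int\<close>).

  From (b) to (c). If \<open>L\<close> is a Rad-supplement of a maximal submodule \<open>N\<close>, then \<open>N \<inter> L\<close> is maximal in
  \<open>L\<close> and is contained in the radical of \<open>L\<close>, that is, in every maximal submodule of \<open>L\<close>; so it is the
  only one and \<open>L\<close> is w-local. Hence the sum \<open>S\<close> of all w-local submodules lies in no maximal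
  submodule \<open>Z\<close>, because \<open>Z\<close> would contain its own Rad-supplement. So \<open>S = M\<close>, and as \<open>M\<close> is finitely
  generated, finitely many w-local submodules suffice.

  From (c) to (a). The heart is \<open>Rad_supplement_cancel_w_local\<close>: if \<open>L\<close> is w-local and \<open>N + L\<close> has a
  Rad-supplement, then so has \<open>N\<close>. If \<open>M\<close> is the sum of the w-local \<open>L\<^sub>1, \<dots>, L\<^sub>n\<close>, then
  \<open>N + L\<^sub>1 + \<dots> + L\<^sub>n = M\<close> has the Rad-supplement zero, and cancelling the summands one at a time
  yields a Rad-supplement of \<open>N\<close>.
\<close>

section \<open>Submodules over an arbitrary ring\<close>

context left_module
begin

text \<open>
  Closure under negation is automatic, as \<open>- x = (- 1) x\<close>.
\<close>

lemma submoduleI: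
  assumes "H \<subseteq> carrier M" "\<zero>\<^bsub>M\<^esub> \<in> H"
    and add: "\<And>x y. \<lbrakk>x \<in> H; y \<in> H\<rbrakk> \<Longrightarrow> x \<oplus>\<^bsub>M\<^esub> y \<in> H"
    and smult: "\<And>a x. \<lbrakk>a \<in> carrier R; x \<in> H\<rbrakk> \<Longrightarrow> a \<odot>\<^bsub>M\<^esub> x \<in> H"
  shows "submodule H R M"
proof -
  have "\<ominus>\<^bsub>M\<^esub> x = (\<ominus> \<one>) \<odot>\<^bsub>M\<^esub> x" if x: "x \<in> carrier M" for x
  proof -
    have "(\<zero> \<odot>\<^bsub>M\<^esub> x) \<oplus>\<^bsub>M\<^esub> (\<zero> \<odot>\<^bsub>M\<^esub> x) = \<zero> \<odot>\<^bsub>M\<^esub> x"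
      using smult_l_distr[of \<zero> \<zero> x] x by simp
    then have "\<zero> \<odot>\<^bsub>M\<^esub> x = \<zero>\<^bsub>M\<^esub>"
      using x by (metis M.add.l_cancel_one smult_closed R.zero_closed)
    then have "(\<ominus> \<one>) \<odot>\<^bsub>M\<^esub> x \<oplus>\<^bsub>M\<^esub> x = \<zero>\<^bsub>M\<^esub>"
      using smult_l_distr[of "\<ominus> \<one>" \<one> x] x by (simp add: R.l_neg)
    then show ?thesis
      using x by (simp add: M.minus_equality)
  qed
  then have "\<ominus>\<^bsub>M\<^esub> x \<in> H" if "x \<in> H" for x
    using that smult[of "\<ominus> \<one>" x] assms(1) by auto
  then show ?thesis
    using assms by unfold_locales (auto simp: a_inv_def)
qed

lemma submoduleD:
  assumes "submodule H R M"
  shows "H \<subseteq> carrier M" "\<zero>\<^bsub>M\<^esub> \<in> H"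
    and "\<And>x y. \<lbrakk>x \<in> H; y \<in> H\<rbrakk> \<Longrightarrow> x \<oplus>\<^bsub>M\<^esub> y \<in> H"
    and "\<And>x y. \<lbrakk>x \<in> H; y \<in> H\<rbrakk> \<Longrightarrow> x \<ominus>\<^bsub>M\<^esub> y \<in> H"
    and "\<And>a x. \<lbrakk>a \<in> carrier R; x \<in> H\<rbrakk> \<Longrightarrow> a \<odot>\<^bsub>M\<^esub> x \<in> H"
proof -
  interpret H: submodule H R M by fact
  show "H \<subseteq> carrier M" "\<zero>\<^bsub>M\<^esub> \<in> H" using H.subset H.one_closed by simp_all
  show "\<And>x y. \<lbrakk>x \<in> H; y \<in> H\<rbrakk> \<Longrightarrow> x \<oplus>\<^bsub>M\<^esub> y \<in> H" using H.m_closed by simp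
  then show "\<And>x y. \<lbrakk>x \<in> H; y \<in> H\<rbrakk> \<Longrightarrow> x \<ominus>\<^bsub>M\<^esub> y \<in> H"
    using H.m_inv_closed by (simp add: a_minus_def a_inv_def)
  show "\<And>a x. \<lbrakk>a \<in> carrier R; x \<in> H\<rbrakk> \<Longrightarrow> a \<odot>\<^bsub>M\<^esub> x \<in> H" by simp
qed

lemma carrier_submodule: "submodule (carrier M) R M"
  by (rule submoduleI) auto

lemma smult_zero: "a \<in> carrier R \<Longrightarrow> a \<odot>\<^bsub>M\<^esub> \<zero>\<^bsub>M\<^esub> = \<zero>\<^bsub>M\<^esub>"
  by (metis M.add.l_cancel_one M.zero_closed M.l_zero smult_closed smult_r_distr)

lemma zero_submodule: "submodule {\<zero>\<^bsub>M\<^esub>} R M"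
  by (rule submoduleI) (auto simp: smult_zero)

lemma Int_submodule:
  assumes "submodule A R M" "submodule B R M"
  shows "submodule (A \<inter> B) R M"
  using submoduleD[OF assms(1)] submoduleD[OF assms(2)] by (intro submoduleI) auto

lemma directed_Union_submodule:
  assumes sub: "\<And>A. A \<in> \<C> \<Longrightarrow> submodule A R M" and "\<C> \<noteq> {}"
    and dir: "\<And>A B. \<lbrakk>A \<in> \<C>; B \<in> \<C>\<rbrakk> \<Longrightarrow> \<exists>C\<in>\<C>. A \<union> B \<subseteq> C"
  shows "submodule (\<Union>\<C>) R M"
proof (rule submoduleI)
  show "\<Union>\<C> \<subseteq> carrier M" "\<zero>\<^bsub>M\<^esub> \<in> \<Union>\<C>"
    using submoduleD(1,2)[OF sub] \<open>\<C> \<noteq> {}\<close> by blast+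
  show "x \<oplus>\<^bsub>M\<^esub> y \<in> \<Union>\<C>" if xy: "x \<in> \<Union>\<C>" "y \<in> \<Union>\<C>" for x y
  proof -
    obtain A B where "A \<in> \<C>" "B \<in> \<C>" "x \<in> A" "y \<in> B" using xy by blast
    with dir[of A B] obtain C where "C \<in> \<C>" "x \<in> C" "y \<in> C" by blast
    then show ?thesis using submoduleD(3)[OF sub] by blast
  qed
  show "a \<odot>\<^bsub>M\<^esub> x \<in> \<Union>\<C>" if "a \<in> carrier R" "x \<in> \<Union>\<C>" for a x
    using that submoduleD(5)[OF sub] by blast
qed

lemma set_add_submodule:
  assumes A: "submodule A R M" and B: "submodule B R M"
  shows "submodule (A <+>\<^bsub>M\<^esub> B) R M"
proof (rule submoduleI)
  note D = submoduleD[OF A] submoduleD[OF B]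
  show "A <+>\<^bsub>M\<^esub> B \<subseteq> carrier M"
    using D(1) D(6) by (rule M.set_add_closed)
  show "\<zero>\<^bsub>M\<^esub> \<in> A <+>\<^bsub>M\<^esub> B"
    using D(2) D(7) by (auto simp: set_add_def' intro!: bexI[of _ "\<zero>\<^bsub>M\<^esub>"])
  show "x \<oplus>\<^bsub>M\<^esub> y \<in> A <+>\<^bsub>M\<^esub> B" if xy: "x \<in> A <+>\<^bsub>M\<^esub> B" "y \<in> A <+>\<^bsub>M\<^esub> B" for x y
  proof -
    obtain a b c d where *: "x = a \<oplus>\<^bsub>M\<^esub> b" "y = c \<oplus>\<^bsub>M\<^esub> d" "a \<in> A" "b \<in> B" "c \<in> A" "d \<in> B"
      using xy by (auto simp: set_add_def')
    then have "a \<in> carrier M" "b \<in> carrier M" "c \<in> carrier M" "d \<in> carrier M"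
      using D(1,6) by auto
    then have "x \<oplus>\<^bsub>M\<^esub> y = (a \<oplus>\<^bsub>M\<^esub> c) \<oplus>\<^bsub>M\<^esub> (b \<oplus>\<^bsub>M\<^esub> d)"
      using * by (simp add: M.a_ac)
    then show ?thesis
      using D(3)[of a c] D(8)[of b d] * by (auto simp: set_add_def')
  qed
  show "r \<odot>\<^bsub>M\<^esub> x \<in> A <+>\<^bsub>M\<^esub> B" if r: "r \<in> carrier R" and x: "x \<in> A <+>\<^bsub>M\<^esub> B" for r x
  proof -
    obtain a b where *: "x = a \<oplus>\<^bsub>M\<^esub> b" "a \<in> A" "b \<in> B"
      using x by (auto simp: set_add_def')
    then have "r \<odot>\<^bsub>M\<^esub> x = r \<odot>\<^bsub>M\<^esub> a \<oplus>\<^bsub>M\<^esub> r \<odot>\<^bsub>M\<^esub> b"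
      using r D(1,6) by (simp add: smult_r_distr subset_eq)
    then show ?thesis
      using D(5)[OF r *(2)] D(10)[OF r *(3)] by (auto simp: set_add_def')
  qed
qed

lemma subset_set_add:
  assumes A: "submodule A R M" and B: "submodule B R M"
  shows "A \<subseteq> A <+>\<^bsub>M\<^esub> B" "B \<subseteq> A <+>\<^bsub>M\<^esub> B"
proof -
  note D = submoduleD[OF A] submoduleD[OF B]
  show "A \<subseteq> A <+>\<^bsub>M\<^esub> B"
  proof
    fix x assume x: "x \<in> A"
    then have "x = x \<oplus>\<^bsub>M\<^esub> \<zero>\<^bsub>M\<^esub>" using D(1) by auto
    then show "x \<in> A <+>\<^bsub>M\<^esub> B" using x D(7) unfolding set_add_def' by blast
  qed
  show "B \<subseteq> A <+>\<^bsub>M\<^esub> B"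
  proof
    fix x assume x: "x \<in> B"
    then have "x = \<zero>\<^bsub>M\<^esub> \<oplus>\<^bsub>M\<^esub> x" using D(6) by auto
    then show "x \<in> A <+>\<^bsub>M\<^esub> B" using x D(2) unfolding set_add_def' by blast
  qed
qed

lemma set_add_least:
  assumes "submodule C R M" "A \<subseteq> C" "B \<subseteq> C"
  shows "A <+>\<^bsub>M\<^esub> B \<subseteq> C"
  using submoduleD(3)[OF assms(1)] assms(2,3) by (auto simp: set_add_def')

lemma set_add_assoc:
  assumes "submodule A R M" "submodule B R M" "submodule C R M"
  shows "(A <+>\<^bsub>M\<^esub> B) <+>\<^bsub>M\<^esub> C = A <+>\<^bsub>M\<^esub> (B <+>\<^bsub>M\<^esub> C)"
  using assms[THEN submoduleD(1)] M.add.set_mult_assoc unfolding set_add_def by simp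

lemma set_add_comm:
  assumes "submodule A R M" "submodule B R M"
  shows "A <+>\<^bsub>M\<^esub> B = B <+>\<^bsub>M\<^esub> A"
proof -
  have "C <+>\<^bsub>M\<^esub> D \<subseteq> D <+>\<^bsub>M\<^esub> C" if "C \<subseteq> carrier M" "D \<subseteq> carrier M" for C D
  proof
    fix x assume "x \<in> C <+>\<^bsub>M\<^esub> D"
    then obtain c d where "c \<in> C" "d \<in> D" "x = c \<oplus>\<^bsub>M\<^esub> d" by (auto simp: set_add_def')
    moreover from this have "x = d \<oplus>\<^bsub>M\<^esub> c" using that by (auto intro: M.a_comm)
    ultimately show "x \<in> D <+>\<^bsub>M\<^esub> C" unfolding set_add_def' by blast
  qed
  with assms[THEN submoduleD(1)] show ?thesis by blast
qed

lemma set_add_zero: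
  assumes "submodule A R M"
  shows "A <+>\<^bsub>M\<^esub> {\<zero>\<^bsub>M\<^esub>} = A"
  using submoduleD(1)[OF assms] by (auto simp: set_add_def' subset_eq)

text \<open>
  Radicals and w-locality are defined for a submodule regarded as a module of its own. The next
  equivalence and \<open>maximal_restrict_iff\<close> turn both into conditions on submodules of \<open>M\<close>, so that all
  arguments can take place inside the one module \<open>M\<close>.
\<close>

lemma submodule_restrict_iff:
  assumes B: "submodule B R M"
  shows "submodule A R (M\<lparr>carrier := B\<rparr>) \<longleftrightarrow> submodule A R M \<and> A \<subseteq> B"
proof -
  have B': "subgroup B (add_monoid M)"
    using B by (simp add: submodule_def)
  have eq: "add_monoid (M\<lparr>carrier := B\<rparr>) = (add_monoid M)\<lparr>carrier := B\<rparr>"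
    by simp
  have "subgroup A ((add_monoid M)\<lparr>carrier := B\<rparr>) \<longleftrightarrow> subgroup A (add_monoid M) \<and> A \<subseteq> B"
    using M.add.subgroup_incl[OF _ B'] M.add.incl_subgroup[OF B']
      subgroup.subset[of A "(add_monoid M)\<lparr>carrier := B\<rparr>"] by auto
  then show ?thesis
    unfolding submodule_def submodule_axioms_def eq by auto
qed


section \<open>Maximal submodules and the radical\<close>

lemma maximal_restrict_iff:
  assumes "submodule B R M"
  shows "maximal_submodule R (M\<lparr>carrier := B\<rparr>) Q \<longleftrightarrow>
    submodule Q R M \<and> Q \<subset> B \<and> (\<forall>K. submodule K R M \<and> Q \<subseteq> K \<and> K \<subseteq> B \<longrightarrow> K = Q \<or> K = B)"
  unfolding maximal_submodule_def submodule_restrict_iff[OF assms] by auto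

text \<open>
  By maximality \<open>Q + A = B\<close>, so \<open>A / (Q \<inter> A)\<close> is isomorphic to the simple module \<open>B / Q\<close>. The proof
  avoids quotients: if \<open>Q \<inter> A \<subseteq> K \<subseteq> A\<close> and \<open>K\<close> is not inside \<open>Q\<close>, then \<open>Q + K = B\<close>, and the modular law
  gives \<open>A = (Q \<inter> A) + K = K\<close>.
\<close>

lemma maximal_Int:
  assumes A: "submodule A R M" and B: "submodule B R M" and "A \<subseteq> B" "\<not> A \<subseteq> Q"
    and Q: "maximal_submodule R (M\<lparr>carrier := B\<rparr>) Q"
  shows "maximal_submodule R (M\<lparr>carrier := A\<rparr>) (Q \<inter> A)"
proof -
  have Qsub: "submodule Q R M" and QB: "Q \<subseteq> B"
    and max: "\<And>K. \<lbrakk>submodule K R M; Q \<subseteq> K; K \<subseteq> B\<rbrakk> \<Longrightarrow> K = Q \<or> K = B"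
    using Q unfolding maximal_restrict_iff[OF B] by auto
  have "K = Q \<inter> A \<or> K = A" if K: "submodule K R M" "Q \<inter> A \<subseteq> K" "K \<subseteq> A" for K
  proof (cases "K \<subseteq> Q")
    case True
    then show ?thesis using K by blast
  next
    case False
    have "Q <+>\<^bsub>M\<^esub> K = B"
      using max[OF set_add_submodule[OF Qsub K(1)] subset_set_add(1)[OF Qsub K(1)]]
        set_add_least[OF B QB, of K] subset_set_add(2)[OF Qsub K(1)] K(3) \<open>A \<subseteq> B\<close> False by auto
    have "A \<subseteq> K"
    proof
      fix x assume x: "x \<in> A"
      then obtain q k where *: "q \<in> Q" "k \<in> K" "x = q \<oplus>\<^bsub>M\<^esub> k"
        using \<open>Q <+>\<^bsub>M\<^esub> K = B\<close> \<open>A \<subseteq> B\<close> unfolding set_add_def' by blast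
      then have "q \<in> carrier M" "k \<in> carrier M"
        using submoduleD(1)[OF Qsub] submoduleD(1)[OF K(1)] by auto
      then have "q = x \<ominus>\<^bsub>M\<^esub> k"
        using * by (simp add: a_minus_def M.a_assoc M.r_neg)
      then have "q \<in> A"
        using submoduleD(4)[OF A x, of k] * K(3) by auto
      then show "x \<in> K"
        using * K(2) submoduleD(3)[OF K(1)] by blast
    qed
    then show ?thesis using K by blast
  qed
  then show ?thesis
    unfolding maximal_restrict_iff[OF A] using Int_submodule[OF Qsub A] \<open>\<not> A \<subseteq> Q\<close> by blast
qed

lemma Rad_eq_carrier: "\<nexists>Q. maximal_submodule R L Q \<Longrightarrow> Rad R L = carrier L"
  by (simp only: Rad_def if_False)

lemma Rad_eq_Inter:
  "maximal_submodule R L Q \<Longrightarrow> Rad R L = \<Inter>{N. maximal_submodule R L N}"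
  unfolding Rad_def by (rule if_P) (rule exI)

lemma Rad_subset_maximal: "maximal_submodule R L Q \<Longrightarrow> Rad R L \<subseteq> Q"
  by (simp add: Rad_eq_Inter Inter_lower)

lemma Rad_subset: "submodule A R M \<Longrightarrow> Rad R (M\<lparr>carrier := A\<rparr>) \<subseteq> A"
proof (cases "\<exists>Q. maximal_submodule R (M\<lparr>carrier := A\<rparr>) Q")
  case True
  assume A: "submodule A R M"
  from True obtain Q where Q: "maximal_submodule R (M\<lparr>carrier := A\<rparr>) Q" ..
  then have "Q \<subseteq> A" using maximal_restrict_iff[OF A] by blast
  with Rad_subset_maximal[OF Q] show ?thesis by blast
qed (simp add: Rad_eq_carrier)

lemma Rad_submodule:
  assumes A: "submodule A R M"
  shows "submodule (Rad R (M\<lparr>carrier := A\<rparr>)) R M"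
proof (cases "\<exists>Q. maximal_submodule R (M\<lparr>carrier := A\<rparr>) Q")
  case True
  then have Rad: "Rad R (M\<lparr>carrier := A\<rparr>) = \<Inter>{Q. maximal_submodule R (M\<lparr>carrier := A\<rparr>) Q}"
    using Rad_eq_Inter by blast
  have D: "submodule Q R M" if "maximal_submodule R (M\<lparr>carrier := A\<rparr>) Q" for Q
    using that maximal_restrict_iff[OF A] by blast
  show ?thesis
  proof (rule submoduleI)
    show "Rad R (M\<lparr>carrier := A\<rparr>) \<subseteq> carrier M"
      using Rad_subset[OF A] submoduleD(1)[OF A] by blast
  qed (use submoduleD[OF D] in \<open>auto simp: Rad\<close>)
next
  case False
  then show ?thesis using A by (simp add: Rad_eq_carrier)
qed

text \<open>
  A maximal submodule of the larger module contains \<open>A\<close> or cuts out a maximal submodule of \<open>A\<close>;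
  either way it contains the radical of \<open>A\<close>.
\<close>

lemma Rad_mono:
  assumes A: "submodule A R M" and B: "submodule B R M" and "A \<subseteq> B"
  shows "Rad R (M\<lparr>carrier := A\<rparr>) \<subseteq> Rad R (M\<lparr>carrier := B\<rparr>)"
proof (cases "\<exists>Q. maximal_submodule R (M\<lparr>carrier := B\<rparr>) Q")
  case True
  have "Rad R (M\<lparr>carrier := A\<rparr>) \<subseteq> Q" if Q: "maximal_submodule R (M\<lparr>carrier := B\<rparr>) Q" for Q
  proof (cases "A \<subseteq> Q")
    case True
    then show ?thesis using Rad_subset[OF A] by blast
  next
    case False
    show ?thesis
      using Rad_subset_maximal[OF maximal_Int[OF A B \<open>A \<subseteq> B\<close> False Q]] by blast
  qed
  then show ?thesis
    using True Rad_eq_Inter by blast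
next
  case False
  then have "Rad R (M\<lparr>carrier := B\<rparr>) = B" by (simp add: Rad_eq_carrier)
  then show ?thesis using Rad_subset[OF A] \<open>A \<subseteq> B\<close> by simp
qed

lemma Rad_w_local:
  assumes "w_local R L" "maximal_submodule R L P"
  shows "Rad R L = P"
proof -
  have "{N. maximal_submodule R L N} = {P}"
    using assms unfolding w_local_def by blast
  with Rad_eq_Inter[OF assms(2)] show ?thesis by simp
qed

text \<open>
  Zorn's lemma applies because a nonempty chain of proper submodules has a proper union: if the union
  were \<open>M\<close>, a finite generating set would already lie in one member of the chain, which would then be
  all of \<open>M\<close>.
\<close>

lemma proper_submodule_in_maximal:
  assumes fg: "finitely_generated_module R M" and N: "submodule N R M" "N \<noteq> carrier M"
  obtains Z where "maximal_submodule R M Z" "N \<subseteq> Z"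
proof -
  obtain S where S: "finite S" "S \<subseteq> carrier M" "generated_submodule R M S = carrier M"
    using fg unfolding finitely_generated_module_def by blast
  have gen: "K = carrier M" if "submodule K R M" "S \<subseteq> K" for K
    using S(3) that submoduleD(1)[OF that(1)] unfolding generated_submodule_def by blast
  define \<A> where "\<A> = {K. submodule K R M \<and> N \<subseteq> K \<and> K \<noteq> carrier M}"
  have "\<exists>Z\<in>\<A>. \<forall>X\<in>\<A>. Z \<subseteq> X \<longrightarrow> X = Z"
  proof (rule subset_Zorn_nonempty)
    show "\<A> \<noteq> {}" using N unfolding \<A>_def by blast
    fix \<C> assume ne: "\<C> \<noteq> {}" and ch: "subset.chain \<A> \<C>"
    have sub: "\<C> \<subseteq> \<A>" and tot: "\<And>A B. \<lbrakk>A \<in> \<C>; B \<in> \<C>\<rbrakk> \<Longrightarrow> A \<subseteq> B \<or> B \<subseteq> A"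
      using ch unfolding subset.chain_def by blast+
    have "submodule (\<Union>\<C>) R M"
    proof (rule directed_Union_submodule)
      show "submodule A R M" if "A \<in> \<C>" for A using that sub unfolding \<A>_def by blast
      show "\<exists>C\<in>\<C>. A \<union> B \<subseteq> C" if "A \<in> \<C>" "B \<in> \<C>" for A B
        using tot[OF that] that by blast
    qed fact
    moreover have "\<Union>\<C> \<noteq> carrier M"
    proof
      assume "\<Union>\<C> = carrier M"
      then obtain C where "C \<in> \<C>" "S \<subseteq> C"
        using finite_subset_Union_chain[OF S(1) _ ne ch] S(2) by blast
      then show False using sub gen unfolding \<A>_def by blast
    qed
    ultimately show "\<Union>\<C> \<in> \<A>"
      using ne sub unfolding \<A>_def by blast
  qed
  then obtain Z where "Z \<in> \<A>" "\<And>X. X \<in> \<A> \<Longrightarrow> Z \<subseteq> X \<Longrightarrow> X = Z" by blast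
  then have "maximal_submodule R M Z" "N \<subseteq> Z"
    unfolding maximal_submodule_def \<A>_def by blast+
  then show thesis by (rule that)
qed

end


section \<open>Rad-supplements and w-local submodules\<close>

text \<open>
  Generating the finite sums of w-local submodules one summand at a time makes cancellation of the
  summands a rule induction; \<open>w_local_sums_iff\<close> below identifies them with the sums of indexed
  families.
\<close>

inductive_set w_local_sums :: "('a, 'r) ring_scheme \<Rightarrow> ('a, 'b, 'm) module_scheme \<Rightarrow> 'b set set"
  for R M where
  zero: "{\<zero>\<^bsub>M\<^esub>} \<in> w_local_sums R M"
| add: "\<lbrakk>F \<in> w_local_sums R M; submodule L R M; w_local R (M\<lparr>carrier := L\<rparr>)\<rbrakk> \<Longrightarrow>
    F <+>\<^bsub>M\<^esub> L \<in> w_local_sums R M"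

context left_module
begin

text \<open>
  The submodule \<open>N \<inter> L\<close> is maximal in \<open>L\<close> and, lying in the radical, is contained in every maximal
  submodule of \<open>L\<close>; hence it is the only one.
\<close>

lemma Rad_supplement_of_maximal_w_local:
  assumes N: "maximal_submodule R M N" and NL: "Rad_supplement R M N L"
  shows "w_local R (M\<lparr>carrier := L\<rparr>)"
proof -
  have L: "submodule L R M" and Nsub: "submodule N R M"
    and sum: "N <+>\<^bsub>M\<^esub> L = carrier M" and int: "N \<inter> L \<subseteq> Rad R (M\<lparr>carrier := L\<rparr>)"
    using NL unfolding Rad_supplement_def by auto
  have "\<not> L \<subseteq> N"
    using N sum set_add_least[OF Nsub order_refl, of L] submoduleD(1)[OF Nsub]
    unfolding maximal_submodule_def by blast
  then have max: "maximal_submodule R (M\<lparr>carrier := L\<rparr>) (N \<inter> L)"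
    using maximal_Int[OF L carrier_submodule submoduleD(1)[OF L]] N by simp
  moreover have "P = N \<inter> L" if P: "maximal_submodule R (M\<lparr>carrier := L\<rparr>) P" for P
  proof -
    have "N \<inter> L \<subseteq> P" using int Rad_subset_maximal[OF P] by blast
    then show ?thesis
      using max P unfolding maximal_restrict_iff[OF L] by blast
  qed
  ultimately show ?thesis unfolding w_local_def by blast
qed

text \<open>
  Let \<open>K\<close> be a Rad-supplement of \<open>N + L\<close>. Either \<open>N + K = M\<close>, and then \<open>K\<close> itself works for \<open>N\<close>. Or
  \<open>N + K\<close> lies in a maximal submodule \<open>Z\<close>; since \<open>N + K + L = M\<close>, the submodule \<open>Z\<close> does not contain
  \<open>L\<close>, so \<open>Z \<inter> L\<close> is the unique maximal submodule of \<open>L\<close>, that is, its radical. Therefore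
  \<open>(N + K) \<inter> L\<close> is contained in the radical of \<open>L\<close>, which is what makes \<open>K + L\<close> a Rad-supplement
  of \<open>N\<close>. The case distinction is needed because a w-local module may have proper submodules outside
  its radical, and \<open>(N + K) \<inter> L\<close> need not lie in it; in the second case it does thanks to \<open>Z\<close>, which
  exists because \<open>M\<close> is finitely generated.
\<close>

lemma Rad_supplement_cancel_w_local:
  assumes fg: "finitely_generated_module R M" and N: "submodule N R M"
    and L: "submodule L R M" "w_local R (M\<lparr>carrier := L\<rparr>)"
    and K: "Rad_supplement R M (N <+>\<^bsub>M\<^esub> L) K"
  shows "\<exists>K'. Rad_supplement R M N K'"
proof -
  have Ksub: "submodule K R M" and sum: "(N <+>\<^bsub>M\<^esub> L) <+>\<^bsub>M\<^esub> K = carrier M"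
    and int: "(N <+>\<^bsub>M\<^esub> L) \<inter> K \<subseteq> Rad R (M\<lparr>carrier := K\<rparr>)"
    using K unfolding Rad_supplement_def by auto
  have NK: "submodule (N <+>\<^bsub>M\<^esub> K) R M" and KL: "submodule (K <+>\<^bsub>M\<^esub> L) R M"
    using N Ksub L(1) by (auto intro: set_add_submodule)
  have sum': "(N <+>\<^bsub>M\<^esub> K) <+>\<^bsub>M\<^esub> L = carrier M"
    using sum set_add_assoc[OF N L(1) Ksub] set_add_assoc[OF N Ksub L(1)] set_add_comm[OF L(1) Ksub]
    by simp
  show ?thesis
  proof (cases "N <+>\<^bsub>M\<^esub> K = carrier M")
    case True
    then have "Rad_supplement R M N K"
      using N Ksub int subset_set_add(1)[OF N L(1)] unfolding Rad_supplement_def by blast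
    then show ?thesis ..
  next
    case False
    then obtain Z where Z: "maximal_submodule R M Z" "N <+>\<^bsub>M\<^esub> K \<subseteq> Z"
      by (rule proper_submodule_in_maximal[OF fg NK])
    have "\<not> L \<subseteq> Z"
      using Z sum' set_add_least[of Z "N <+>\<^bsub>M\<^esub> K" L] submoduleD(1)[of Z]
      unfolding maximal_submodule_def by blast
    then have "maximal_submodule R (M\<lparr>carrier := L\<rparr>) (Z \<inter> L)"
      using maximal_Int[OF L(1) carrier_submodule submoduleD(1)[OF L(1)]] Z(1) by simp
    then have int': "(N <+>\<^bsub>M\<^esub> K) \<inter> L \<subseteq> Rad R (M\<lparr>carrier := L\<rparr>)"
      using Rad_w_local[OF L(2)] Z(2) by blast
    let ?Rad = "Rad R (M\<lparr>carrier := K <+>\<^bsub>M\<^esub> L\<rparr>)"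
    have "x \<in> ?Rad" if x: "x \<in> N" "x \<in> K <+>\<^bsub>M\<^esub> L" for x
    proof -
      obtain k l where kl: "k \<in> K" "l \<in> L" "x = k \<oplus>\<^bsub>M\<^esub> l"
        using x(2) by (auto simp: set_add_def')
      have car: "x \<in> carrier M" "k \<in> carrier M" "l \<in> carrier M"
        using x(1) kl submoduleD(1)[OF N] submoduleD(1)[OF Ksub] submoduleD(1)[OF L(1)] by auto
      have NLsub: "submodule (N <+>\<^bsub>M\<^esub> L) R M"
        using N L(1) by (rule set_add_submodule)
      \<comment> \<open>Each component of \<open>x\<close> is a difference of \<open>x \<in> N\<close> and the other component, which puts it
        into the intersection that one of the two radicals contains.\<close>
      have "k = x \<ominus>\<^bsub>M\<^esub> l"
        using car(2,3) unfolding kl(3) by (simp add: a_minus_def M.a_assoc M.r_neg)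
      moreover have "l = x \<ominus>\<^bsub>M\<^esub> k"
        using car(2,3) unfolding kl(3)
        by (simp add: a_minus_def M.a_assoc M.r_neg M.a_comm[of k l])
      ultimately have "k \<in> N <+>\<^bsub>M\<^esub> L" "l \<in> N <+>\<^bsub>M\<^esub> K"
        using submoduleD(4)[OF NLsub, of x l] submoduleD(4)[OF NK, of x k] x(1) kl(1,2)
          subset_set_add[OF N L(1)] subset_set_add[OF N Ksub] by auto
      then have "k \<in> ?Rad" "l \<in> ?Rad"
        using int int' kl(1,2) Rad_mono[OF Ksub KL] Rad_mono[OF L(1) KL]
          subset_set_add[OF Ksub L(1)] by blast+
      moreover have "submodule ?Rad R M"
        using KL by (rule Rad_submodule)
      ultimately show ?thesis
        using submoduleD(3) kl(3) by blast
    qed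
    then have "Rad_supplement R M N (K <+>\<^bsub>M\<^esub> L)"
      using N KL sum' set_add_assoc[OF N Ksub L(1)] unfolding Rad_supplement_def by auto
    then show ?thesis ..
  qed
qed

lemma submodule_family_sum_Suc:
  assumes "\<And>i. i \<le> n \<Longrightarrow> W i \<subseteq> carrier M"
  shows "submodule_family_sum M W {..<Suc n} = submodule_family_sum M W {..<n} <+>\<^bsub>M\<^esub> W n"
proof -
  have fin: "finsum M x {..<Suc n} = finsum M x {..<n} \<oplus>\<^bsub>M\<^esub> x n"
    if "x \<in> Pi {..<Suc n} W" for x
  proof -
    have "x i \<in> carrier M" if "i \<le> n" for i
      using Pi_mem[OF \<open>x \<in> Pi {..<Suc n} W\<close>, of i] assms[OF that] that by auto
    then have "x \<in> {..<n} \<rightarrow> carrier M" "x n \<in> carrier M" by auto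
    then show ?thesis by (simp add: lessThan_Suc M.a_comm)
  qed
  show ?thesis
  proof (intro equalityI subsetI)
    fix y assume "y \<in> submodule_family_sum M W {..<Suc n}"
    then obtain x where "x \<in> Pi {..<Suc n} W" "y = finsum M x {..<Suc n}"
      unfolding submodule_family_sum_def by blast
    then show "y \<in> submodule_family_sum M W {..<n} <+>\<^bsub>M\<^esub> W n"
      using fin[of x] unfolding set_add_def' submodule_family_sum_def by (auto simp: lessThan_Suc)
  next
    fix y assume "y \<in> submodule_family_sum M W {..<n} <+>\<^bsub>M\<^esub> W n"
    then obtain x b where x: "x \<in> Pi {..<n} W" and b: "b \<in> W n"
      and y: "y = finsum M x {..<n} \<oplus>\<^bsub>M\<^esub> b"
      unfolding submodule_family_sum_def set_add_def' by blast
    let ?x = "x(n := b)"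
    have x': "?x \<in> Pi {..<Suc n} W" using x b by (auto simp: Pi_iff less_Suc_eq)
    have "x i \<in> carrier M" if "i < n" for i
      using Pi_mem[OF x, of i] assms[of i] that by auto
    then have "finsum M ?x {..<n} = finsum M x {..<n}"
      by (intro M.finsum_cong') auto
    then have "y = finsum M ?x {..<Suc n}" using fin[OF x'] y by simp
    then show "y \<in> submodule_family_sum M W {..<Suc n}"
      using x' unfolding submodule_family_sum_def by blast
  qed
qed

lemma w_local_sums_iff:
  "F \<in> w_local_sums R M \<longleftrightarrow>
    (\<exists>(n::nat) W. (\<forall>i<n. submodule (W i) R M \<and> w_local R (M\<lparr>carrier := W i\<rparr>)) \<and>
      F = submodule_family_sum M W {..<n})"
proof
  assume "F \<in> w_local_sums R M"
  then show "\<exists>(n::nat) W. (\<forall>i<n. submodule (W i) R M \<and> w_local R (M\<lparr>carrier := W i\<rparr>)) \<and>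
      F = submodule_family_sum M W {..<n}"
  proof induction
    case zero
    show ?case by (intro exI[of _ "0::nat"]) (auto simp: submodule_family_sum_def)
  next
    case (add F L)
    then obtain n :: nat and W where W: "\<forall>i<n. submodule (W i) R M \<and> w_local R (M\<lparr>carrier := W i\<rparr>)"
      and F: "F = submodule_family_sum M W {..<n}" by blast
    let ?W = "W(n := L)"
    have W': "\<forall>i<Suc n. submodule (?W i) R M \<and> w_local R (M\<lparr>carrier := ?W i\<rparr>)"
      using W add.hyps by (auto simp: less_Suc_eq)
    have "Pi {..<n} ?W = Pi {..<n} W" by (auto simp: Pi_iff)
    then have "F = submodule_family_sum M ?W {..<n}"
      unfolding F submodule_family_sum_def by simp
    then have "F <+>\<^bsub>M\<^esub> L = submodule_family_sum M ?W {..<Suc n}"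
      using submodule_family_sum_Suc[of n ?W] W'[rule_format, THEN conjunct1, THEN submoduleD(1)]
      by simp
    with W' show ?case by blast
  qed
next
  assume "\<exists>(n::nat) W. (\<forall>i<n. submodule (W i) R M \<and> w_local R (M\<lparr>carrier := W i\<rparr>)) \<and>
      F = submodule_family_sum M W {..<n}"
  then obtain n :: nat and W where W: "\<forall>i<n. submodule (W i) R M \<and> w_local R (M\<lparr>carrier := W i\<rparr>)"
    and F: "F = submodule_family_sum M W {..<n}" by blast
  show "F \<in> w_local_sums R M"
    using W unfolding F
  proof (induction n)
    case 0
    show ?case using w_local_sums.zero[of M R] by (simp add: submodule_family_sum_def)
  next
    case (Suc n)
    then have "submodule_family_sum M W {..<n} <+>\<^bsub>M\<^esub> W n \<in> w_local_sums R M"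
      by (intro w_local_sums.add) auto
    then show ?case
      using submodule_family_sum_Suc[of n W] Suc.prems[rule_format, THEN conjunct1, THEN submoduleD(1)]
      by simp
  qed
qed

lemma w_local_sums_submodule: "F \<in> w_local_sums R M \<Longrightarrow> submodule F R M"
  by (induction rule: w_local_sums.induct) (auto intro: zero_submodule set_add_submodule)

lemma w_local_sums_set_add:
  assumes "G \<in> w_local_sums R M" "F \<in> w_local_sums R M"
  shows "F <+>\<^bsub>M\<^esub> G \<in> w_local_sums R M"
  using assms
proof induction
  case zero
  then show ?case by (simp add: set_add_zero w_local_sums_submodule)
next
  case (add G L)
  then have "(F <+>\<^bsub>M\<^esub> G) <+>\<^bsub>M\<^esub> L \<in> w_local_sums R M"
    by (auto intro: w_local_sums.add)
  then show ?case
    using add by (simp add: set_add_assoc w_local_sums_submodule)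
qed

lemma Rad_supplement_cancel_w_local_sum:
  assumes fg: "finitely_generated_module R M" and F: "F \<in> w_local_sums R M"
    and "submodule N R M" and "\<exists>K. Rad_supplement R M (N <+>\<^bsub>M\<^esub> F) K"
  shows "\<exists>K. Rad_supplement R M N K"
  using F assms(3,4)
proof (induction arbitrary: N)
  case zero
  then show ?case by (simp add: set_add_zero)
next
  case (add F L)
  have Fsub: "submodule F R M" using add.hyps(1) by (rule w_local_sums_submodule)
  have "\<exists>K. Rad_supplement R M ((N <+>\<^bsub>M\<^esub> F) <+>\<^bsub>M\<^esub> L) K"
    using add.prems by (simp add: set_add_assoc Fsub add.hyps(2))
  then have "\<exists>K. Rad_supplement R M (N <+>\<^bsub>M\<^esub> F) K"
    using Rad_supplement_cancel_w_local[OF fg set_add_submodule[OF add.prems(1) Fsub] add.hyps(2,3)]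
    by blast
  then show ?case using add.IH add.prems(1) by blast
qed

text \<open>
  Here \<open>N + M = M\<close> has zero as a Rad-supplement, and the summand \<open>M\<close> is a finite sum of w-local
  submodules, hence can be cancelled.
\<close>

lemma Rad_supplemented_if_w_local_sum:
  assumes fg: "finitely_generated_module R M" and M: "carrier M \<in> w_local_sums R M"
  shows "Rad_supplemented R M"
  unfolding Rad_supplemented_def
proof (intro allI impI)
  fix N assume N: "submodule N R M"
  have "N <+>\<^bsub>M\<^esub> carrier M = carrier M"
    using subset_set_add(2)[OF N carrier_submodule]
      set_add_least[OF carrier_submodule submoduleD(1)[OF N] order_refl] by blast
  moreover have "Rad_supplement R M (carrier M) {\<zero>\<^bsub>M\<^esub>}"
    using set_add_zero[OF carrier_submodule] submoduleD(2)[OF Rad_submodule[OF zero_submodule]]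
      carrier_submodule zero_submodule unfolding Rad_supplement_def by simp
  ultimately show "\<exists>K. Rad_supplement R M N K"
    using Rad_supplement_cancel_w_local_sum[OF fg M N] by auto
qed

text \<open>
  The finite sums of w-local submodules are directed, so their union is a submodule. A maximal
  submodule \<open>Z\<close> containing this union would contain its own Rad-supplement \<open>L\<close>, as \<open>L\<close> is w-local,
  contradicting \<open>Z + L = M\<close>. So the union is \<open>M\<close>, and by directedness a finite generating set lies in
  a single finite sum.
\<close>

lemma w_local_sum_if_maximal_supplements:
  assumes fg: "finitely_generated_module R M"
    and suppl: "\<And>N. maximal_submodule R M N \<Longrightarrow> \<exists>L. Rad_supplement R M N L"
  shows "carrier M \<in> w_local_sums R M"
proof -
  let ?S = "\<Union>(w_local_sums R M)"
  have dir: "\<exists>C\<in>w_local_sums R M. A \<union> B \<subseteq> C"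
    if "A \<in> w_local_sums R M" "B \<in> w_local_sums R M" for A B
    using w_local_sums_set_add[OF that(2,1)] subset_set_add[OF that[THEN w_local_sums_submodule]]
    by blast
  have ne: "w_local_sums R M \<noteq> {}" using w_local_sums.zero by blast
  have S: "submodule ?S R M"
    using w_local_sums_submodule ne dir by (rule directed_Union_submodule)
  have "?S = carrier M"
  proof (rule ccontr)
    assume "?S \<noteq> carrier M"
    then obtain Z where Z: "maximal_submodule R M Z" "?S \<subseteq> Z"
      by (rule proper_submodule_in_maximal[OF fg S])
    then obtain L where L: "Rad_supplement R M Z L" using suppl by blast
    have Lsub: "submodule L R M" and Zsub: "submodule Z R M" and sum: "Z <+>\<^bsub>M\<^esub> L = carrier M"
      using L unfolding Rad_supplement_def by auto
    have "{\<zero>\<^bsub>M\<^esub>} <+>\<^bsub>M\<^esub> L \<in> w_local_sums R M"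
      using w_local_sums.zero Lsub Rad_supplement_of_maximal_w_local[OF Z(1) L]
      by (rule w_local_sums.add)
    then have "L \<subseteq> Z"
      using Z(2) subset_set_add(2)[OF zero_submodule Lsub] by blast
    then have "carrier M \<subseteq> Z"
      using set_add_least[OF Zsub order_refl] sum by blast
    then show False
      using Z(1) submoduleD(1)[OF Zsub] unfolding maximal_submodule_def by blast
  qed
  obtain G where G: "finite G" "G \<subseteq> carrier M" "generated_submodule R M G = carrier M"
    using fg unfolding finitely_generated_module_def by blast
  have fin: "\<exists>F\<in>w_local_sums R M. G' \<subseteq> F" if "finite G'" "G' \<subseteq> ?S" for G'
    using that
  proof induction
    case empty
    then show ?case using ne by blast
  next
    case (insert x G')
    then obtain A B where "A \<in> w_local_sums R M" "B \<in> w_local_sums R M" "x \<in> A" "G' \<subseteq> B"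
      by blast
    then show ?case using dir[of A B] by blast
  qed
  have "G \<subseteq> ?S" using G(2) \<open>?S = carrier M\<close> by simp
  with fin[OF G(1)] obtain F where F: "F \<in> w_local_sums R M" "G \<subseteq> F" by blast
  have Fsub: "submodule F R M" using F(1) by (rule w_local_sums_submodule)
  then have "F = carrier M"
    using G(3) F(2) submoduleD(1)[OF Fsub] unfolding generated_submodule_def by blast
  with F(1) show ?thesis by simp
qed

end


section \<open>The three equivalent conditions\<close>

theorem corollary3p8:
  fixes R :: "('a, 'r) ring_scheme" and M :: "('a, 'b, 'm) module_scheme"
  assumes "left_module R M"
    and "finitely_generated_module R M"
  shows "(Rad_supplemented R M \<longleftrightarrow>
           (\<forall>N. maximal_submodule R M N \<longrightarrow> (\<exists>L. Rad_supplement R M N L)))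
       \<and> ((\<forall>N. maximal_submodule R M N \<longrightarrow> (\<exists>L. Rad_supplement R M N L)) \<longleftrightarrow>
           (\<exists>(n::nat) W. (\<forall>i<n. submodule (W i) R M \<and> w_local R (M\<lparr>carrier := W i\<rparr>)) \<and>
              carrier M = submodule_family_sum M W {..<n}))"
proof -
  interpret left_module R M by fact
  have "Rad_supplemented R M \<Longrightarrow> maximal_submodule R M N \<Longrightarrow> \<exists>L. Rad_supplement R M N L" for N
    unfolding Rad_supplemented_def maximal_submodule_def by blast
  then show ?thesis
    unfolding w_local_sums_iff[symmetric]
    using Rad_supplemented_if_w_local_sum[OF assms(2)]
      w_local_sum_if_maximal_supplements[OF assms(2)] by blast
qed

end
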